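(* In the setting of the context, consider the quasi-optimal cell average decomposition (CAD) for the $\mathbb P^k$-based DG scheme, with $$\theta=\frac{a_1/\Delta x-a_2/\Delta y}{a_1/\Delta x+a_2/\Delta y},\qquad \overline\omega_\star^{\mathtt Q}=\frac{\overline\omega_{\star,0}\,\omega_1^{\mathtt{GL}}}{\overline\omega_{\star,0}|\theta|+\omega_1^{\mathtt{GL}}(1-|\theta|)},\qquad \overline\omega_{\star,0}:=\overline\omega_\star(0,\mathbb P^k),\quad \omega_1^{\mathtt{GL}}=\frac1{L(L-1)},\quad L=\Big\lceil\frac{k+3}2\Big\rceil .$$ If for all $i,j$ the (limited) DG solution polynomial $\tilde p_{ij}$ satisfies $$\tilde u^+_{i-\frac12,q}\in G,\quad \tilde u^-_{i+\frac12,q}\in G,\quad \tilde u^+_{q,j-\frac12}\in G,\quad \tilde u^-_{q,j+\frac12}\in G,\qquad q=1,\dots,Q,$$ and $$\Pi_{ij}:=\frac{\bar u_{ij}^n-\overline\omega_\star^{\mathtt Q}\Big[\frac{1+\theta}2\sum_{q=1}^Q\omega_q^{\mathtt G}\big(\tilde u^+_{i-\frac12,q}+\tilde u^-_{i+\frac12,q}\big)+\frac{1-\theta}2\sum_{q=1}^Q\omega_q^{\mathtt G}\big(\tilde u^+_{q,j-\frac12}+\tilde u^-_{q,j+\frac12}\big)\Big]}{1-2\overline\omega_\star^{\mathtt Q}}\in G,$$ then the scheme with the bound-preserving limiter (i.e. the scheme of the context, using the limited polynomials) preserves $\bar u_{ij}^{n+1}\in G$ under the CFL condition $$\Delta t\Big(\frac{a_1}{\Delta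 x}+\frac{a_2}{\Delta y}\Big)\le\overline\omega_\star^{\mathtt Q}\,c_0 .$$
   Context: Setting. $G\subset\mathbb R^m$ is convex; $a_1,a_2,\Delta x,\Delta y,c_0,\Delta t>0$ ($a_1,a_2$ are the maximum characteristic speeds in the $x$- and $y$-directions); $k\in\mathbb N_+$. The plane is partitioned into rectangles $\Omega_{ij}=[x_{i-\frac12},x_{i+\frac12}]\times[y_{j-\frac12},y_{j+\frac12}]$ of size $\Delta x\times\Delta y$. On each $\Omega_{ij}$ there is an $\mathbb R^m$-valued polynomial $\tilde p_{ij}$ (the DG solution at time level $n$ after limiting) with components in $\mathbb P^k$ (real polynomials of total degree at most $k$) and cell average $\bar u_{ij}^n=\frac1{\Delta x\Delta y}\iint_{\Omega_{ij}}\tilde p_{ij}$. $Q$ is such that the $Q$-point Gauss quadrature rule is exact for univariate polynomials of degree $\le k$; $\omega_q^{\mathtt G}$ are its weights (normalized to sum to one), and $x_{i,q}^{\mathtt G}$, $y_{j,q}^{\mathtt G}$ its nodes in $[x_{i-\frac12},x_{i+\frac12}]$, $[y_{j-\frac12},y_{j+\frac12}]$. In row $j$ (resp. column $i$) the interface values are, for all $i$ (resp. $j$), $$\tilde u^+_{i-\frac12,q}=\tilde p_{ij}(x_{i-\frac12},y_{j,q}^{\mathtt G}),\quad \tilde u^-_{i+\frac12,q}=\tilde p_{ij}(x_{i+\frac12},y_{j,q}^{\mathtt G}),\quad \tilde u^+_{q,j-\frac12}=\tilde p_{ij}(x_{i,q}^{\mathtt G},y_{j-\frac12}),\quad \tilde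 u^-_{q,j+\frac12}=\tilde p_{ij}(x_{i,q}^{\mathtt G},y_{j+\frac12}).$$ The scheme for cell averages is $$\bar u_{ij}^{n+1}=\bar u_{ij}^n-\tfrac{\Delta t}{\Delta x}\sum_{q}\omega_q^{\mathtt G}\big[\hat f_1(\tilde u^-_{i+\frac12,q},\tilde u^+_{i+\frac12,q})-\hat f_1(\tilde u^-_{i-\frac12,q},\tilde u^+_{i-\frac12,q})\big]-\tfrac{\Delta t}{\Delta y}\sum_{q}\omega_q^{\mathtt G}\big[\hat f_2(\tilde u^-_{q,j+\frac12},\tilde u^+_{q,j+\frac12})-\hat f_2(\tilde u^-_{q,j-\frac12},\tilde u^+_{q,j-\frac12})\big].$$ The numerical fluxes $\hat f_1,\hat f_2$ are bound-preserving: for $r=1,2$, every $\lambda>0$ with $a_r\lambda\le c_0$ and all $u_1,u_2,u_3\in G$, $u_2-\lambda(\hat f_r(u_2,u_3)-\hat f_r(u_1,u_2))\in G$. Weights and quasi-optimal CAD. Let $\Omega=[-1,1]^2$, $\langle p\rangle_\Omega=\frac14\iint_\Omega p$, $\langle p\rangle_\Omega^x=\frac14\int_{-1}^1[p(-1,y)+p(1,y)]dy$, $\langle p\rangle_\Omega^y=\frac14\int_{-1}^1[p(x,-1)+p(x,1)]dx$, $\overline{p(a,b)}=\frac14[p(a,b)+p(-a,b)+p(a,-b)+p(-a,-b)]$. For $\theta\in[-1,1]$, a symmetric CAD with boundary weight $\overline\omega>0$ is an identity $\langle p\rangle_\Omega=\overline\omega[(1+\theta)\langle p\rangle_\Omega^x+(1-\theta)\langle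 p\rangle_\Omega^y]+\sum_{s=1}^S\omega_s\overline{p(x^{(s)},y^{(s)})}$ valid for all $p\in\mathbb P^k$ with $S$ finite, all $\omega_s>0$, all $(x^{(s)},y^{(s)})\in[0,1]^2$; $\overline\omega_\star(\theta,\mathbb P^k)$ is the maximum of such $\overline\omega$ (it is attained), and an optimal CAD is one attaining it. $\omega_1^{\mathtt{GL}}$ is the endpoint weight of the $L$-point Gauss–Lobatto rule (weights normalized to sum to one) and equals $\overline\omega_\star(\pm1,\mathbb P^k)$. The quasi-optimal CAD for $\theta$ is the convex combination $\tau\cdot[\text{optimal CAD for }\theta=-1]+(1-\tau)\cdot[\text{optimal CAD for }\theta=0]$ if $\theta\in[-1,0]$, and $\tau\cdot[\text{optimal CAD for }\theta=1]+(1-\tau)\cdot[\text{optimal CAD for }\theta=0]$ if $\theta\in[0,1]$, with $\tau=\overline\omega_{\star,0}|\theta|/(\overline\omega_{\star,0}|\theta|+\omega_1^{\mathtt{GL}}(1-|\theta|))$, where for $\theta=\mp1$ the optimal CAD is the one given by the tensor product of the $L$-point Gauss–Lobatto rule (in $y$ for $\theta=-1$, in $x$ for $\theta=1$) and the Gauss rule in the other variable. It is a symmetric CAD for $\theta$ with boundary weight $\overline\omega_\star^{\mathtt Q}$. *)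

theory Defs
  imports "HOL-Analysis.Analysis" "HOL-Computational_Algebra.Polynomial"
begin

section \<open>Cell average decompositions on the reference square\<close>

text \<open>Bivariate real polynomials of total degree at most \<open>k\<close>, as polynomial functions.\<close>

definition Pk :: "nat \<Rightarrow> (real \<times> real \<Rightarrow> real) set" where
  "Pk k = {p. \<exists>c :: nat \<Rightarrow> nat \<Rightarrow> real. \<forall>x y.
     p (x, y) = (\<Sum>a\<le>k. \<Sum>b\<le>k - a. c a b * x ^ a * y ^ b)}"

definition ref_avg :: "(real \<times> real \<Rightarrow> real) \<Rightarrow> real" where
  "ref_avg p = 1 / 4 * integral ({-1..1} \<times> {-1..1}) p"

definition ref_avg_x :: "(real \<times> real \<Rightarrow> real) \<Rightarrow> real" where
  "ref_avg_x p = 1 / 4 * integral {-1..1} (\<lambda>y. p (-1, y) + p (1, y))"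

definition ref_avg_y :: "(real \<times> real \<Rightarrow> real) \<Rightarrow> real" where
  "ref_avg_y p = 1 / 4 * integral {-1..1} (\<lambda>x. p (x, -1) + p (x, 1))"

definition sym_avg :: "(real \<times> real \<Rightarrow> real) \<Rightarrow> real \<times> real \<Rightarrow> real" where
  "sym_avg p z = (case z of (a, b) \<Rightarrow> 1 / 4 * (p (a, b) + p (-a, b) + p (a, -b) + p (-a, -b)))"

text \<open>\<open>S = 0\<close> (no interior nodes) is allowed: for \<open>k = 1\<close> the maximal boundary weight is
  \<open>1 / 2\<close>, and it is attained only without interior nodes.\<close>

definition symmetric_CAD ::
  "nat \<Rightarrow> real \<Rightarrow> real \<Rightarrow> nat \<Rightarrow> (nat \<Rightarrow> real) \<Rightarrow> (nat \<Rightarrow> real \<times> real) \<Rightarrow> bool" where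
  "symmetric_CAD k \<theta> w S \<omega> z \<longleftrightarrow>
     w > 0 \<and>
     (\<forall>s\<in>{1..S}. \<omega> s > 0 \<and> z s \<in> {0..1} \<times> {0..1}) \<and>
     (\<forall>p\<in>Pk k. ref_avg p =
        w * ((1 + \<theta>) * ref_avg_x p + (1 - \<theta>) * ref_avg_y p)
        + (\<Sum>s = 1..S. \<omega> s * sym_avg p (z s)))"

text \<open>The set below is bounded above by \<open>1 / 2\<close> (take \<open>p = 1\<close>); its supremum is in fact
  a maximum.\<close>

definition omega_star :: "real \<Rightarrow> nat \<Rightarrow> real" where
  "omega_star \<theta> k = Sup {w. \<exists>S \<omega> z. symmetric_CAD k \<theta> w S \<omega> z}"

definition GL_points :: "nat \<Rightarrow> nat" where
  "GL_points k = nat \<lceil>(real k + 3) / 2\<rceil>"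

text \<open>Endpoint weight of the Gauss--Lobatto rule with \<open>GL_points k\<close> nodes, the weights being
  normalized to sum to one.\<close>

definition omega_GL :: "nat \<Rightarrow> real" where
  "omega_GL k = 1 / (real (GL_points k) * (real (GL_points k) - 1))"

text \<open>Boundary weight of the quasi-optimal symmetric CAD for \<open>\<theta>\<close>, i.e. of the convex combination
  of the optimal CADs for \<open>sgn \<theta>\<close> and for \<open>0\<close> with coefficient
  \<open>omega_star 0 k * \<bar>\<theta>\<bar> / (omega_star 0 k * \<bar>\<theta>\<bar> + omega_GL k * (1 - \<bar>\<theta>\<bar>))\<close> on the former.\<close>

definition omega_quasi :: "real \<Rightarrow> nat \<Rightarrow> real" where
  "omega_quasi \<theta> k =
     omega_star 0 k * omega_GL k / (omega_star 0 k * \<bar>\<theta>\<bar> + omega_GL k * (1 - \<bar>\<theta>\<bar>))"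


section \<open>Gauss quadrature\<close>

definition quadrature_exact :: "nat \<Rightarrow> nat \<Rightarrow> (nat \<Rightarrow> real) \<Rightarrow> (nat \<Rightarrow> real) \<Rightarrow> bool" where
  "quadrature_exact d Q \<xi> \<omega> \<longleftrightarrow>
     (\<forall>p :: real poly. degree p \<le> d \<longrightarrow>
        (\<Sum>q = 1..Q. \<omega> q * poly p (\<xi> q)) = 1 / 2 * integral {-1..1} (poly p))"

text \<open>The \<open>Q\<close>-point Gauss rule on \<open>[-1, 1]\<close> is, up to the order of the nodes, the only rule with
  \<open>Q\<close> nodes that is exact up to degree \<open>2 * Q - 1\<close>.\<close>

definition gauss_rule :: "nat \<Rightarrow> (nat \<Rightarrow> real) \<Rightarrow> (nat \<Rightarrow> real) \<Rightarrow> bool" where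
  "gauss_rule Q \<xi> \<omega> \<longleftrightarrow>
     Q \<ge> 1 \<and> inj_on \<xi> {1..Q} \<and> \<xi> ` {1..Q} \<subseteq> {-1..1} \<and>
     quadrature_exact (2 * Q - 1) Q \<xi> \<omega>"

definition affine_node :: "real \<Rightarrow> real \<Rightarrow> real \<Rightarrow> real" where
  "affine_node a b t = (a + b) / 2 + (b - a) / 2 * t"


section \<open>The scheme for the cell averages\<close>

text \<open>Half-integer indices are shifted: \<open>X i\<close> and \<open>Y j\<close> stand for \<open>x\<close> and \<open>y\<close> with index
  \<open>i - 1/2\<close> and \<open>j - 1/2\<close>, so cell \<open>(i, j)\<close> is \<open>{X i..X (i + 1)} \<times> {Y j..Y (j + 1)}\<close>.
  Likewise the first (in \<open>x\<close>) or second (in \<open>y\<close>) index of an interface value below is that of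
  the interface, so that \<open>ux_minus X Y \<xi> p (i + 1) j q\<close> is the value at index \<open>i + 1/2\<close> taken
  from cell \<open>(i, j)\<close>.\<close>

definition cell_avg ::
  "(int \<Rightarrow> real) \<Rightarrow> (int \<Rightarrow> real) \<Rightarrow> (int \<Rightarrow> int \<Rightarrow> real \<times> real \<Rightarrow> real ^ 'm) \<Rightarrow> int \<Rightarrow> int \<Rightarrow> real ^ 'm"
  where
  "cell_avg X Y p i j = (1 / ((X (i + 1) - X i) * (Y (j + 1) - Y j))) *\<^sub>R
     integral ({X i..X (i + 1)} \<times> {Y j..Y (j + 1)}) (p i j)"

context
  fixes X Y :: "int \<Rightarrow> real" and \<xi> :: "nat \<Rightarrow> real"
    and p :: "int \<Rightarrow> int \<Rightarrow> real \<times> real \<Rightarrow> real ^ 'm"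
begin

definition ux_plus :: "int \<Rightarrow> int \<Rightarrow> nat \<Rightarrow> real ^ 'm" where
  "ux_plus i j q = p i j (X i, affine_node (Y j) (Y (j + 1)) (\<xi> q))"

definition ux_minus :: "int \<Rightarrow> int \<Rightarrow> nat \<Rightarrow> real ^ 'm" where
  "ux_minus i j q = p (i - 1) j (X i, affine_node (Y j) (Y (j + 1)) (\<xi> q))"

definition uy_plus :: "int \<Rightarrow> int \<Rightarrow> nat \<Rightarrow> real ^ 'm" where
  "uy_plus i j q = p i j (affine_node (X i) (X (i + 1)) (\<xi> q), Y j)"

definition uy_minus :: "int \<Rightarrow> int \<Rightarrow> nat \<Rightarrow> real ^ 'm" where
  "uy_minus i j q = p i (j - 1) (affine_node (X i) (X (i + 1)) (\<xi> q), Y j)"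

end

definition bound_preserving_flux ::
  "(real ^ 'm) set \<Rightarrow> real \<Rightarrow> real \<Rightarrow> (real ^ 'm \<Rightarrow> real ^ 'm \<Rightarrow> real ^ 'm) \<Rightarrow> bool" where
  "bound_preserving_flux G a c0 f \<longleftrightarrow>
     (\<forall>\<mu>>0. a * \<mu> \<le> c0 \<longrightarrow>
        (\<forall>u1\<in>G. \<forall>u2\<in>G. \<forall>u3\<in>G. u2 - \<mu> *\<^sub>R (f u2 u3 - f u1 u2) \<in> G))"

end

theory Submission
  imports Defs
begin

text \<open>
  By the definition of \<open>\<Pi>\<close>, the cell average is a convex combination of \<open>\<Pi>\<close> and the traces on
  the boundary of the cell. Each flux difference of the scheme is distributed over the two opposite
  traces by inserting the flux between them, so that the new average becomes a convex combination of
  \<open>\<Pi>\<close> and one-dimensional three-point updates, which lie in \<open>G\<close> under the CFL condition. This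
  needs \<open>0 < \<omega>Q \<le> 1/2\<close>, hence bounds on the supremum \<open>omega_star 0 k\<close>: it is positive because
  some symmetric CAD exists (a tensor product of the Gauss rule and a positive rule containing the
  end points), and testing on \<open>1\<close> and \<open>x\<^sup>2\<close> bounds it by \<open>1/2\<close>, and by \<open>1/4\<close> for \<open>k \<ge> 2\<close>. So the
  degenerate case \<open>\<omega>Q = 1/2\<close> occurs only for \<open>k = 1\<close>, where the averages over the cell
  and over either pair of opposite edges are all the value at the centre.
\<close>

section \<open>Monomial averages on the reference square\<close>

text \<open>Keeping \<open>d\<close> and \<open>h\<close> general serves both the moments of [-1, 1]
  and, later, affine images of the Gauss rule.\<close>

lemma has_integral_affine_power:
  fixes d h :: real
  assumes "h \<noteq> 0"
  shows "((\<lambda>x. (d + h * x) ^ a) has_integral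
           ((d + h) ^ Suc a - (d - h) ^ Suc a) / (real (Suc a) * h)) {-1..1}"
proof -
  have "((\<lambda>x. (d + h * x) ^ Suc a / (real (Suc a) * h)) has_vector_derivative (d + h * x) ^ a)
      (at x within {-1..1})" for x
    unfolding has_real_derivative_iff_has_vector_derivative[symmetric]
    using assms by (auto intro!: derivative_eq_intros simp: field_simps simp del: power_Suc of_nat_Suc)
  from fundamental_theorem_of_calculus[OF _ this]
  show ?thesis by (simp add: diff_divide_distrib)
qed

text \<open>The mean of \<open>x ^ a\<close> over [-1, 1].\<close>

definition mean_power :: "nat \<Rightarrow> real" where
  "mean_power a = (if even a then 1 / real (Suc a) else 0)"

lemma has_integral_power: "((\<lambda>x::real. x ^ a) has_integral 2 * mean_power a) {-1..1}"
  using has_integral_affine_power[of 1 0 a] by (auto simp: mean_power_def)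

lemma has_integral_Pk_sections:
  fixes c :: "nat \<Rightarrow> nat \<Rightarrow> real"
  shows "((\<lambda>y. \<Sum>a\<le>k. \<Sum>b\<le>k - a. c a b * x ^ a * y ^ b) has_integral
           (\<Sum>a\<le>k. \<Sum>b\<le>k - a. c a b * x ^ a * (2 * mean_power b))) {-1..1}"
    and "((\<lambda>x. \<Sum>a\<le>k. \<Sum>b\<le>k - a. c a b * x ^ a * y ^ b) has_integral
           (\<Sum>a\<le>k. \<Sum>b\<le>k - a. c a b * (2 * mean_power a) * y ^ b)) {-1..1}"
  by (intro has_integral_sum has_integral_mult_right has_integral_mult_left has_integral_power
      finite_atMost)+

lemma continuous_on_Pk:
  assumes "p \<in> Pk k" shows "continuous_on S p"
proof -
  obtain c where "\<forall>x y. p (x, y) = (\<Sum>a\<le>k. \<Sum>b\<le>k - a. c a b * x ^ a * y ^ b)"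
    using assms by (auto simp: Pk_def)
  then have "p = (\<lambda>z. \<Sum>a\<le>k. \<Sum>b\<le>k - a. c a b * fst z ^ a * snd z ^ b)"
    by (auto simp: fun_eq_iff)
  then show ?thesis by (auto intro!: continuous_intros)
qed

text \<open>Each functional is linear in the coefficients. Opposite edges and reflected points
  cancel odd powers, which is the source of the \<open>of_bool\<close> factors; the area integral is
  computed by iterated integration.\<close>

lemma ref_avg_monomials:
  assumes p: "\<And>x y. p (x, y) = (\<Sum>a\<le>k. \<Sum>b\<le>k - a. c a b * x ^ a * y ^ b)"
  shows "ref_avg p = (\<Sum>a\<le>k. \<Sum>b\<le>k - a. c a b * (mean_power a * mean_power b))"
    and "ref_avg_x p = (\<Sum>a\<le>k. \<Sum>b\<le>k - a. c a b * (of_bool (even a) * mean_power b))"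
    and "ref_avg_y p = (\<Sum>a\<le>k. \<Sum>b\<le>k - a. c a b * (of_bool (even b) * mean_power a))"
    and "sym_avg p (s, t) = (\<Sum>a\<le>k. \<Sum>b\<le>k - a.
           c a b * (of_bool (even a) * of_bool (even b) * (s ^ a * t ^ b)))"
proof -
  have "p \<in> Pk k" using p by (auto simp: Pk_def)
  then have "integral ({-1..1} \<times> {-1..1}) p = integral {-1..1} (\<lambda>x. integral {-1..1} (\<lambda>y. p (x, y)))"
    using integral_prod_continuous[of "-1" "-1" 1 1 p] continuous_on_Pk
    by (simp add: cbox_Pair_eq)
  also have "\<dots> = integral {-1..1} (\<lambda>x. \<Sum>a\<le>k. \<Sum>b\<le>k - a. c a b * x ^ a * (2 * mean_power b))"
    unfolding p has_integral_Pk_sections(1)[THEN integral_unique] ..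
  also have "\<dots> = (\<Sum>a\<le>k. \<Sum>b\<le>k - a. c a b * (2 * mean_power a) * (2 * mean_power b))"
    by (intro integral_unique has_integral_sum has_integral_mult_right has_integral_mult_left
        has_integral_power finite_atMost)
  finally show "ref_avg p = (\<Sum>a\<le>k. \<Sum>b\<le>k - a. c a b * (mean_power a * mean_power b))"
    by (simp add: ref_avg_def sum_distrib_left algebra_simps)
  have "((\<lambda>y. p (-1, y) + p (1, y)) has_integral
      (\<Sum>a\<le>k. \<Sum>b\<le>k - a. c a b * (-1) ^ a * (2 * mean_power b)) +
      (\<Sum>a\<le>k. \<Sum>b\<le>k - a. c a b * 1 ^ a * (2 * mean_power b))) {-1..1}"
    unfolding p by (intro has_integral_add has_integral_Pk_sections)
  then show "ref_avg_x p = (\<Sum>a\<le>k. \<Sum>b\<le>k - a. c a b * (of_bool (even a) * mean_power b))"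
    by (auto simp: ref_avg_x_def integral_unique sum_distrib_left sum.distrib[symmetric]
        simp del: mult_minus_left intro!: sum.cong)
  have "((\<lambda>x. p (x, -1) + p (x, 1)) has_integral
      (\<Sum>a\<le>k. \<Sum>b\<le>k - a. c a b * (2 * mean_power a) * (-1) ^ b) +
      (\<Sum>a\<le>k. \<Sum>b\<le>k - a. c a b * (2 * mean_power a) * 1 ^ b)) {-1..1}"
    unfolding p by (intro has_integral_add has_integral_Pk_sections)
  then show "ref_avg_y p = (\<Sum>a\<le>k. \<Sum>b\<le>k - a. c a b * (of_bool (even b) * mean_power a))"
    by (auto simp: ref_avg_y_def integral_unique sum_distrib_left sum.distrib[symmetric]
        simp del: mult_minus_left intro!: sum.cong)
  show "sym_avg p (s, t) = (\<Sum>a\<le>k. \<Sum>b\<le>k - a.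
           c a b * (of_bool (even a) * of_bool (even b) * (s ^ a * t ^ b)))"
    unfolding sym_avg_def prod.case p sum.distrib[symmetric] sum_distrib_left
    by (intro sum.cong refl) (auto simp: of_bool_def)
qed

text \<open>The Kronecker delta supplies the coefficients that \<open>Pk\<close> asks for when the
  polynomial is a single monomial.\<close>

lemma triangle_sum_delta:
  fixes g :: "nat \<Rightarrow> nat \<Rightarrow> real"
  assumes "a + b \<le> k"
  shows "(\<Sum>a'\<le>k. \<Sum>b'\<le>k - a'. of_bool (a' = a \<and> b' = b) * g a' b') = g a b"
proof -
  have "(\<Sum>b'\<le>k - a'. of_bool (a' = a \<and> b' = b) * g a' b') = (if a' = a then g a b else 0)" for a'
  proof -
    have "(\<Sum>b'\<le>k - a'. of_bool (a' = a \<and> b' = b) * g a' b')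
        = (\<Sum>b'\<le>k - a'. if b' = b then of_bool (a' = a) * g a b else 0)"
      by (intro sum.cong) auto
    then show ?thesis using assms by auto
  qed
  then show ?thesis using assms by simp
qed

lemma monomial_in_Pk:
  assumes "a + b \<le> k"
  shows "(\<lambda>z. fst z ^ a * snd z ^ b) \<in> Pk k"
  unfolding Pk_def
  using triangle_sum_delta[OF assms, of "\<lambda>a b. _ ^ a * _ ^ b"]
  by (auto intro!: exI[of _ "\<lambda>a' b'. of_bool (a' = a \<and> b' = b)"] simp: mult.assoc)

lemma monomial_averages:
  defines "p \<equiv> \<lambda>a b z. fst z ^ a * snd z ^ b"
  shows "ref_avg (p a b) = mean_power a * mean_power b"
    and "ref_avg_x (p a b) = of_bool (even a) * mean_power b"
    and "ref_avg_y (p a b) = of_bool (even b) * mean_power a"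
    and "sym_avg (p a b) (s, t) = of_bool (even a) * of_bool (even b) * (s ^ a * t ^ b)"
proof -
  have p: "p a b (x, y) = (\<Sum>a'\<le>a + b. \<Sum>b'\<le>a + b - a'.
      of_bool (a' = a \<and> b' = b) * x ^ a' * y ^ b')" for x y
    using triangle_sum_delta[of a b "a + b" "\<lambda>a b. x ^ a * y ^ b"] by (simp add: p_def mult.assoc)
  show "ref_avg (p a b) = mean_power a * mean_power b"
    "ref_avg_x (p a b) = of_bool (even a) * mean_power b"
    "ref_avg_y (p a b) = of_bool (even b) * mean_power a"
    "sym_avg (p a b) (s, t) = of_bool (even a) * of_bool (even b) * (s ^ a * t ^ b)"
    unfolding ref_avg_monomials[of "p a b", OF p] triangle_sum_delta[OF order_refl] by simp_all
qed

section \<open>Symmetric CADs as moment conditions, and upper bounds on their boundary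
  weight\<close>

text \<open>Both sides of the CAD identity are linear in \<open>p\<close>, so monomials suffice; if
  an exponent is odd, every term vanishes by symmetry.\<close>

lemma symmetric_CAD_iff_moments:
  "symmetric_CAD k \<theta> w S \<omega> z \<longleftrightarrow>
     w > 0 \<and> (\<forall>s\<in>{1..S}. \<omega> s > 0 \<and> z s \<in> {0..1} \<times> {0..1}) \<and>
     (\<forall>a b. a + b \<le> k \<longrightarrow> even a \<longrightarrow> even b \<longrightarrow>
        1 / real (Suc a) * (1 / real (Suc b)) =
        w * ((1 + \<theta>) * (1 / real (Suc b)) + (1 - \<theta>) * (1 / real (Suc a)))
        + (\<Sum>s = 1..S. \<omega> s * (fst (z s) ^ a * snd (z s) ^ b)))"
    (is "_ \<longleftrightarrow> _ \<and> _ \<and> (\<forall>a b. _ \<longrightarrow> _ \<longrightarrow> _ \<longrightarrow> ?M a b)")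
proof -
  define e where "e a = (of_bool (even a) :: real)" for a :: nat
  \<comment> \<open>\<open>D\<close> is the defect of the CAD identity as a functional, and
    \<open>m a b\<close> below is its value on a monomial.\<close>
  define D where "D p = ref_avg p - (w * ((1 + \<theta>) * ref_avg_x p + (1 - \<theta>) * ref_avg_y p)
        + (\<Sum>s = 1..S. \<omega> s * sym_avg p (z s)))" for p
  define m where "m a b = mean_power a * mean_power b
      - (w * ((1 + \<theta>) * (e a * mean_power b) + (1 - \<theta>) * (e b * mean_power a))
        + (\<Sum>s = 1..S. \<omega> s * (e a * e b * (fst (z s) ^ a * snd (z s) ^ b))))" for a b
  have D_mono: "D (\<lambda>z. fst z ^ a * snd z ^ b) = m a b" for a b
  proof -
    have "sym_avg (\<lambda>z. fst z ^ a * snd z ^ b) (z s) =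
        e a * e b * (fst (z s) ^ a * snd (z s) ^ b)" for s
      using monomial_averages(4)[of a b "fst (z s)" "snd (z s)"] by (simp add: e_def)
    then show ?thesis by (simp add: D_def m_def e_def monomial_averages)
  qed
  have D_sum: "D p = (\<Sum>a\<le>k. \<Sum>b\<le>k - a. c a b * m a b)"
    if p: "\<And>x y. p (x, y) = (\<Sum>a\<le>k. \<Sum>b\<le>k - a. c a b * x ^ a * y ^ b)" for p c
  proof -
    have "sym_avg p (z s) = (\<Sum>a\<le>k. \<Sum>b\<le>k - a. c a b * (e a * e b * (fst (z s) ^ a * snd (z s) ^ b)))"
      for s using ref_avg_monomials(4)[of p, OF p, of "fst (z s)" "snd (z s)"] by (simp add: e_def)
    then have "(\<Sum>s = 1..S. \<omega> s * sym_avg p (z s)) = (\<Sum>a\<le>k. \<Sum>b\<le>k - a. c a b *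
        (\<Sum>s = 1..S. \<omega> s * (e a * e b * (fst (z s) ^ a * snd (z s) ^ b))))"
      by (simp add: sum_distrib_left mult.left_commute sum.swap[of _ "{Suc 0..S}"])
    then show ?thesis
      unfolding D_def m_def ref_avg_monomials(1-3)[of p, OF p] e_def[symmetric]
      by (simp add: sum_distrib_left sum.distrib sum_subtractf algebra_simps)
  qed
  have m_iff: "m a b = 0 \<longleftrightarrow> (even a \<longrightarrow> even b \<longrightarrow> ?M a b)" for a b
    by (auto simp: m_def e_def mean_power_def)
  have "(\<forall>p\<in>Pk k. D p = 0) \<longleftrightarrow> (\<forall>a b. a + b \<le> k \<longrightarrow> m a b = 0)"
  proof safe
    fix a b assume "\<forall>p\<in>Pk k. D p = 0" "a + b \<le> k"
    then show "m a b = 0" using monomial_in_Pk D_mono by metis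
  next
    fix p assume m: "\<forall>a b. a + b \<le> k \<longrightarrow> m a b = 0" and "p \<in> Pk k"
    then obtain c where "\<And>x y. p (x, y) = (\<Sum>a\<le>k. \<Sum>b\<le>k - a. c a b * x ^ a * y ^ b)"
      by (auto simp: Pk_def)
    from D_sum[OF this] show "D p = 0" using m by simp
  qed
  then show ?thesis unfolding symmetric_CAD_def D_def m_iff by simp
qed

lemma symmetric_CAD_moment:
  assumes "symmetric_CAD k \<theta> w S \<omega> z" "a + b \<le> k" "even a" "even b"
  shows "1 / real (Suc a) * (1 / real (Suc b)) =
    w * ((1 + \<theta>) * (1 / real (Suc b)) + (1 - \<theta>) * (1 / real (Suc a)))
    + (\<Sum>s = 1..S. \<omega> s * (fst (z s) ^ a * snd (z s) ^ b))"
  using assms unfolding symmetric_CAD_iff_moments by simp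

lemma symmetric_CAD_weight_le:
  assumes "symmetric_CAD k \<theta> w S \<omega> z"
  shows "w \<le> 1 / 2"
proof -
  have pos: "\<omega> s > 0" if "s \<in> {1..S}" for s using assms that by (auto simp: symmetric_CAD_def)
  have "1 = 2 * w + (\<Sum>s = 1..S. \<omega> s)"
    using symmetric_CAD_moment[OF assms, of 0 0] by (simp add: algebra_simps)
  moreover have "(\<Sum>s = 1..S. \<omega> s) \<ge> 0" using pos by (intro sum_nonneg) (simp add: less_imp_le)
  ultimately show ?thesis by simp
qed

text \<open>For \<open>x ^ 2\<close> the edge averages contribute \<open>w * (1 + 1 / 3)\<close> to
  the mean \<open>1 / 3\<close>, and the interior nodes contribute nonnegatively.\<close>

lemma symmetric_CAD_weight_le_quarter:
  assumes "symmetric_CAD k 0 w S \<omega> z" "k \<ge> 2"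
  shows "w \<le> 1 / 4"
proof -
  have pos: "\<omega> s > 0" if "s \<in> {1..S}" for s using assms that by (auto simp: symmetric_CAD_def)
  have "1 / 3 = 4 / 3 * w + (\<Sum>s = 1..S. \<omega> s * fst (z s) ^ 2)"
    using symmetric_CAD_moment[OF assms(1), of 2 0] assms(2) by (simp add: algebra_simps)
  moreover have "(\<Sum>s = 1..S. \<omega> s * fst (z s) ^ 2) \<ge> 0"
    using pos by (intro sum_nonneg) (simp add: less_imp_le)
  ultimately show ?thesis by simp
qed

section \<open>Lagrange interpolation and positivity of the Gauss weights\<close>

lemma degree_node_poly_le:
  fixes t :: "nat \<Rightarrow> real"
  shows "finite J \<Longrightarrow> degree (\<Prod>j\<in>J. [:- t j, 1:]) \<le> card J"
  using degree_prod_sum_le[of J "\<lambda>j. [:- t j, 1:]"] by simp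

text \<open>The coefficients are the Lagrange basis polynomials evaluated at \<open>s\<close>, hence
  the same for all \<open>p\<close>.\<close>

lemma lagrange_evaluation:
  fixes t :: "nat \<Rightarrow> real"
  assumes "finite I" "inj_on t I"
  obtains c where "\<And>p. degree p < card I \<Longrightarrow> poly p s = (\<Sum>i\<in>I. c i * poly p (t i))"
proof -
  define N where "N i = (\<Prod>j\<in>I - {i}. [:- t j, 1:])" for i
  have N_other: "poly (N i) (t j) = 0" if "j \<in> I" "j \<noteq> i" for i j
    using that assms by (auto simp: N_def poly_prod)
  have N_self: "poly (N i) (t i) \<noteq> 0" if "i \<in> I" for i
    using that assms by (auto simp: N_def poly_prod inj_on_def)
  have "poly p s = (\<Sum>i\<in>I. poly (N i) s / poly (N i) (t i) * poly p (t i))"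
    if deg: "degree p < card I" for p
  proof -
    \<comment> \<open>The interpolation error has degree below the number of its roots, so it is
      zero.\<close>
    define D where "D = p - (\<Sum>i\<in>I. smult (poly p (t i) / poly (N i) (t i)) (N i))"
    have "degree (N i) < card I" if "i \<in> I" for i
      using degree_node_poly_le[of "I - {i}" t] that assms card_gt_0_iff[of I]
      by (auto simp: N_def)
    then have "degree (\<Sum>i\<in>I. smult (poly p (t i) / poly (N i) (t i)) (N i)) < card I"
      using deg by (intro degree_sum_less) (auto intro: le_less_trans[OF degree_smult_le])
    then have degD: "degree D < card I" using deg by (simp add: D_def degree_diff_less)
    have "poly D (t j) = 0" if "j \<in> I" for j
    proof -
      have "(\<Sum>i\<in>I. poly p (t i) / poly (N i) (t i) * poly (N i) (t j))
          = (\<Sum>i\<in>I. if i = j then poly p (t j) else 0)"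
        using N_other N_self that by (intro sum.cong) auto
      then show ?thesis using that assms by (simp add: D_def poly_sum)
    qed
    then have sub: "t ` I \<subseteq> {x. poly D x = 0}" by auto
    have "D = 0"
    proof (rule ccontr)
      assume "D \<noteq> 0"
      then have "card (t ` I) \<le> degree D"
        using card_mono[OF poly_roots_finite sub] card_poly_roots_bound[of D] by linarith
      then show False using degD assms by (simp add: card_image)
    qed
    then have "p = (\<Sum>i\<in>I. smult (poly p (t i) / poly (N i) (t i)) (N i))" by (simp add: D_def)
    then have "poly p s = poly (\<Sum>i\<in>I. smult (poly p (t i) / poly (N i) (t i)) (N i)) s" by simp
    then show ?thesis by (simp add: poly_sum mult.commute)
  qed
  then show thesis by (rule that)
qed

text \<open>The square of the node polynomial without node \<open>r\<close> has degree at most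
  \<open>2 * Q - 2\<close>, so the rule integrates it exactly, and only the term of \<open>r\<close>
  survives.\<close>

lemma gauss_weight_pos:
  assumes "gauss_rule Q \<xi> \<omega>" "r \<in> {1..Q}"
  shows "\<omega> r > 0"
proof -
  define N where "N = (\<Prod>j\<in>{1..Q} - {r}. [:- \<xi> j, 1:])"
  have deg: "degree (N ^ 2) \<le> 2 * Q - 1"
    using degree_node_poly_le[of "{1..Q} - {r}" \<xi>] assms(2) degree_power_le[of N 2]
    by (simp add: N_def)
  have N_other: "poly N (\<xi> j) = 0" if "j \<in> {1..Q}" "j \<noteq> r" for j
    using that assms by (auto simp: N_def poly_prod)
  have N_self: "poly N (\<xi> r) \<noteq> 0"
    using inj_onD[of \<xi> "{1..Q}" r] assms by (auto simp: N_def poly_prod gauss_rule_def)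
  have "(\<Sum>q = 1..Q. \<omega> q * poly (N ^ 2) (\<xi> q))
      = (\<Sum>q = 1..Q. if q = r then \<omega> r * poly N (\<xi> r) ^ 2 else 0)"
    using N_other by (intro sum.cong) auto
  moreover have "(\<Sum>q = 1..Q. \<omega> q * poly (N ^ 2) (\<xi> q)) = 1 / 2 * integral {-1..1} (poly (N ^ 2))"
    using assms(1) deg unfolding gauss_rule_def quadrature_exact_def by blast
  ultimately have rule: "\<omega> r * poly N (\<xi> r) ^ 2 = 1 / 2 * integral {-1..1} (poly (N ^ 2))"
    using assms(2) by simp
  have "N \<noteq> 0" using N_self by auto
  have cont: "continuous_on {-1..1} (poly (N ^ 2))" by (intro continuous_intros)
  \<comment> \<open>A continuous nonnegative function with zero integral vanishes on the whole
    interval, which would give \<open>N\<close> infinitely many roots.\<close>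
  have "integral {-1..1} (poly (N ^ 2)) \<noteq> 0"
  proof
    assume "integral {-1..1} (poly (N ^ 2)) = 0"
    then have "\<forall>x\<in>{-1..1}. poly (N ^ 2) x = 0"
      by (subst (asm) integral_eq_0_iff[OF cont]) auto
    then have "{-1..1} \<subseteq> {x. poly N x = 0}" by auto
    then have "finite {-1..1::real}" using poly_roots_finite[OF \<open>N \<noteq> 0\<close>] finite_subset by blast
    then show False using infinite_Icc[of "-1" "1::real"] by simp
  qed
  moreover have "integral {-1..1} (poly (N ^ 2)) \<ge> 0"
    using cont by (intro integral_nonneg integrable_continuous_interval) auto
  ultimately have "\<omega> r * poly N (\<xi> r) ^ 2 > 0" using rule by simp
  then show ?thesis using zero_less_mult_pos2[of "\<omega> r" "poly N (\<xi> r) ^ 2"] N_self by simp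
qed

section \<open>Existence of a symmetric CAD\<close>

text \<open>An affine substitution preserves degree, so exactness passes to the interval with end
  points \<open>d - h\<close> and \<open>d + h\<close>.\<close>

lemma quadrature_exact_affine_power:
  assumes "quadrature_exact k Q \<xi> \<omega>" "a \<le> k" "h \<noteq> 0"
  shows "(\<Sum>q = 1..Q. \<omega> q * (d + h * \<xi> q) ^ a) =
    ((d + h) ^ Suc a - (d - h) ^ Suc a) / (real (Suc a) * h) / 2"
proof -
  have "degree ([:d, h:] ^ a) \<le> k"
    using degree_power_le[of "[:d, h:]" a] assms by simp
  then have exact: "(\<Sum>q = 1..Q. \<omega> q * poly ([:d, h:] ^ a) (\<xi> q)) =
      1 / 2 * integral {-1..1} (poly ([:d, h:] ^ a))"
    using assms(1) unfolding quadrature_exact_def by blast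
  have eval: "poly ([:d, h:] ^ a) = (\<lambda>x. (d + h * x) ^ a)" by (auto simp: mult.commute)
  show ?thesis
    using exact unfolding eval
    unfolding has_integral_affine_power[OF assms(3), THEN integral_unique] by simp
qed

text \<open>The composite Gauss rule on \<open>k + 1\<close> panels of \<open>[0, 1]\<close> has enough nodes to express
  the value at \<open>1\<close> by Lagrange interpolation; subtracting a small multiple of that expression
  keeps the weights positive.\<close>

lemma positive_rule_with_endpoint:
  assumes "gauss_rule Q \<xi> \<omega>" "quadrature_exact k Q \<xi> \<omega>"
  obtains e and I :: "(nat \<times> nat) set" and v t where
    "e > 0" "finite I" "\<And>i. i \<in> I \<Longrightarrow> v i > 0" "\<And>i. i \<in> I \<Longrightarrow> t i \<in> {0..1}"
    "\<And>a. a \<le> k \<Longrightarrow> 1 / real (Suc a) = e + (\<Sum>i\<in>I. v i * t i ^ a :: real)"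
proof -
  define N where "N = real (Suc k)"
  \<comment> \<open>For \<open>i = (r, q)\<close> this is the image of Gauss node \<open>q\<close>
    in the panel from \<open>r / N\<close> to \<open>(r + 1) / N\<close>.\<close>
  define t where "t i = (real (fst i) + (1 + \<xi> (snd i)) / 2) / N" for i :: "nat \<times> nat"
  have "N > 0" by (simp add: N_def)
  have \<xi>: "\<xi> q \<in> {-1..1}" if "q \<in> {1..Q}" for q
    using assms(1) that unfolding gauss_rule_def by blast
  have Q: "1 \<in> {1..Q}" using assms(1) by (auto simp: gauss_rule_def)
  have pos: "\<omega> q > 0" if "q \<in> {1..Q}" for q using gauss_weight_pos[OF assms(1) that] .
  have t01: "t (r, q) \<in> {0..1}" if "r \<in> {..k}" "q \<in> {1..Q}" for r q
  proof -
    have "real r + (1 + \<xi> q) / 2 \<le> N"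
    proof -
      have "real r \<le> real k" "(1 + \<xi> q) / 2 \<le> 1" using \<xi>[OF that(2)] that(1) by auto
      then show ?thesis unfolding N_def of_nat_Suc by linarith
    qed
    then show ?thesis using \<xi>[OF that(2)] \<open>N > 0\<close> by (simp add: t_def)
  qed
  have panel: "(\<Sum>q = 1..Q. \<omega> q * t (r, q) ^ a) =
      N * ((real (Suc r) / N) ^ Suc a - (real r / N) ^ Suc a) / real (Suc a)" if "a \<le> k" for a r
  proof -
    define h where "h = 1 / (2 * N)"
    define d where "d = (2 * real r + 1) / (2 * N)"
    have t_eq: "t (r, q) = d + h * \<xi> q" for q using \<open>N > 0\<close> by (simp add: t_def d_def h_def field_simps)
    have eqs: "d + h = real (Suc r) / N" "d - h = real r / N" "h \<noteq> 0"
      using \<open>N > 0\<close> by (simp_all add: d_def h_def field_simps)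
    have "Z / (R * h) / 2 = N * Z / R" for Z R by (simp add: h_def)
    then show ?thesis
      unfolding t_eq quadrature_exact_affine_power[OF assms(2) that eqs(3)] eqs(1,2) by blast
  qed
  have composite: "(\<Sum>r\<le>k. \<Sum>q = 1..Q. \<omega> q / N * t (r, q) ^ a) = 1 / real (Suc a)" if "a \<le> k" for a
  proof -
    have "(\<Sum>q = 1..Q. \<omega> q / N * t (r, q) ^ a) =
        ((real (Suc r) / N) ^ Suc a - (real r / N) ^ Suc a) / real (Suc a)" for r
      using panel[OF that, of r] \<open>N > 0\<close>
      by (simp add: sum_divide_distrib[symmetric] del: of_nat_Suc power_Suc)
    then have "(\<Sum>r\<le>k. \<Sum>q = 1..Q. \<omega> q / N * t (r, q) ^ a) =
        (\<Sum>r<Suc k. (real (Suc r) / N) ^ Suc a - (real r / N) ^ Suc a) / real (Suc a)"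
      by (simp add: sum_divide_distrib lessThan_Suc_atMost del: of_nat_Suc power_Suc)
    also have "(\<Sum>r<Suc k. (real (Suc r) / N) ^ Suc a - (real r / N) ^ Suc a) = 1"
      using \<open>N > 0\<close> by (subst sum_lessThan_telescope) (simp add: N_def)
    finally show ?thesis .
  qed
  \<comment> \<open>Interpolation uses only the node \<open>q = 1\<close> of each panel: these are
    \<open>k + 1\<close> distinct points, as degree \<open>k\<close> requires.\<close>
  have "inj_on (\<lambda>r. t (r, 1)) {..k}" using \<open>N > 0\<close> by (auto simp: inj_on_def t_def)
  then obtain c where c: "\<And>p. degree p < card {..k} \<Longrightarrow> poly p 1 = (\<Sum>r\<le>k. c r * poly p (t (r, 1)))"
    using lagrange_evaluation[of "{..k}" "\<lambda>r. t (r, 1)" 1] by auto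
  have value_at_1: "1 = (\<Sum>r\<le>k. c r * t (r, 1) ^ a)" if "a \<le> k" for a
    using c[of "monom 1 a"] that by (simp add: poly_monom degree_monom_eq)
  \<comment> \<open>The summand 1 makes \<open>C\<close> positive and strictly larger than every
    \<open>c r\<close>, so \<open>e * c r\<close> stays strictly below the composite weight
    \<open>\<omega> 1 / N\<close>.\<close>
  define C where "C = 1 + (\<Sum>r\<le>k. \<bar>c r\<bar>)"
  have "C > 0" unfolding C_def by (smt (verit) sum_nonneg abs_ge_zero)
  define e where "e = \<omega> 1 / N / C"
  have "e > 0" using pos[OF Q] \<open>N > 0\<close> \<open>C > 0\<close> by (simp add: e_def)
  have small: "e * c r < \<omega> 1 / N" if "r \<le> k" for r
  proof -
    have "\<bar>c r\<bar> \<le> (\<Sum>r\<le>k. \<bar>c r\<bar>)" using that by (intro member_le_sum) auto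
    then have "c r < C" by (simp add: C_def)
    then have "e * c r < e * C" using \<open>e > 0\<close> by simp
    then show ?thesis using \<open>C > 0\<close> by (simp add: e_def)
  qed
  define v where "v i = \<omega> (snd i) / N - (if snd i = 1 then e * c (fst i) else 0)" for i :: "nat \<times> nat"
  show thesis
  proof (rule that[of e "{..k} \<times> {1..Q}" v t])
    fix i assume i: "i \<in> {..k} \<times> {1..Q}"
    then show "v i > 0"
      using small[of "fst i"] pos[of "snd i"] \<open>N > 0\<close> by (auto simp: v_def)
    show "t i \<in> {0..1}" using i t01 by auto
  next
    fix a assume "a \<le> k"
    have "(\<Sum>i\<in>{..k} \<times> {1..Q}. v i * t i ^ a) = (\<Sum>r\<le>k. \<Sum>q = 1..Q. v (r, q) * t (r, q) ^ a)"
      by (simp add: sum.cartesian_product split_def)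
    also have "\<dots> = (\<Sum>r\<le>k. (\<Sum>q = 1..Q. \<omega> q / N * t (r, q) ^ a) - e * (c r * t (r, 1) ^ a))"
    proof (intro sum.cong refl)
      fix r
      have "(\<Sum>q = 1..Q. v (r, q) * t (r, q) ^ a) = (\<Sum>q = 1..Q. \<omega> q / N * t (r, q) ^ a -
          (if q = 1 then e * (c r * t (r, 1) ^ a) else 0))"
        by (intro sum.cong refl) (auto simp: v_def left_diff_distrib mult.assoc)
      also have "\<dots> = (\<Sum>q = 1..Q. \<omega> q / N * t (r, q) ^ a) - e * (c r * t (r, 1) ^ a)"
        unfolding sum_subtractf using Q by simp
      finally show "(\<Sum>q = 1..Q. v (r, q) * t (r, q) ^ a) = \<dots>" .
    qed
    also have "\<dots> = 1 / real (Suc a) - e"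
      using composite[OF \<open>a \<le> k\<close>] value_at_1[OF \<open>a \<le> k\<close>]
      by (simp add: sum_subtractf sum_distrib_left[symmetric])
    finally show "1 / real (Suc a) = e + (\<Sum>i\<in>{..k} \<times> {1..Q}. v i * t i ^ a)" by simp
  qed (use \<open>e > 0\<close> in auto)
qed

text \<open>Allows nodes indexed by a product set instead of an initial segment of the
  naturals.\<close>

lemma symmetric_CAD_of_finite_set:
  assumes "w > 0" "finite J" "\<And>i. i \<in> J \<Longrightarrow> v i > 0" "\<And>i. i \<in> J \<Longrightarrow> y i \<in> {0..1} \<times> {0..1}"
    and "\<And>a b. a + b \<le> k \<Longrightarrow> even a \<Longrightarrow> even b \<Longrightarrow>
        1 / real (Suc a) * (1 / real (Suc b)) =
        w * ((1 + \<theta>) * (1 / real (Suc b)) + (1 - \<theta>) * (1 / real (Suc a)))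
        + (\<Sum>i\<in>J. v i * (fst (y i) ^ a * snd (y i) ^ b))"
  shows "\<exists>S \<omega> z. symmetric_CAD k \<theta> w S \<omega> z"
proof -
  obtain g where g: "bij_betw g {1..card J} J"
    using ex_bij_betw_nat_finite_1[OF assms(2)] by blast
  have "g s \<in> J" if "s \<in> {1..card J}" for s using g that by (auto simp: bij_betw_def)
  moreover have "(\<Sum>i\<in>J. v i * (fst (y i) ^ a * snd (y i) ^ b)) =
      (\<Sum>s = 1..card J. v (g s) * (fst (y (g s)) ^ a * snd (y (g s)) ^ b))" for a b
    using sum.reindex_bij_betw[OF g, of "\<lambda>i. v i * (fst (y i) ^ a * snd (y i) ^ b)"] by simp
  ultimately have "symmetric_CAD k \<theta> w (card J) (v \<circ> g) (y \<circ> g)"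
    using assms unfolding symmetric_CAD_iff_moments by simp
  then show ?thesis by blast
qed

text \<open>Averages the two tensor products of the end-point rule in one variable with the Gauss
  rule in the other. The end-point weight \<open>e\<close> yields the edge averages, each with
  factor \<open>e / 2\<close>, which corresponds to \<open>\<theta> = 0\<close>.\<close>

lemma symmetric_CAD_exists:
  assumes "gauss_rule Q \<xi> \<omega>" "quadrature_exact k Q \<xi> \<omega>"
  shows "\<exists>w S \<omega> z. symmetric_CAD k 0 w S \<omega> z"
proof -
  obtain e and I :: "(nat \<times> nat) set" and v t where "e > 0" "finite I"
    and v: "\<And>i. i \<in> I \<Longrightarrow> v i > 0" and t: "\<And>i. i \<in> I \<Longrightarrow> t i \<in> {0..1}"
    and rule: "\<And>a. a \<le> k \<Longrightarrow> 1 / real (Suc a) = e + (\<Sum>i\<in>I. v i * t i ^ a :: real)"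
    by (rule positive_rule_with_endpoint[OF assms]) blast
  \<comment> \<open>Gauss nodes are folded into [0, 1] by absolute values; the moment conditions
    involve even powers only.\<close>
  have \<xi>: "\<bar>\<xi> q\<bar> \<in> {0..1}" if "q \<in> {1..Q}" for q
  proof -
    have "\<xi> q \<in> {-1..1}" using assms(1) that unfolding gauss_rule_def by blast
    then show ?thesis by auto
  qed
  have pos: "\<omega> q > 0" if "q \<in> {1..Q}" for q using gauss_weight_pos[OF assms(1) that] .
  have gauss: "1 / real (Suc a) = (\<Sum>q = 1..Q. \<omega> q * \<bar>\<xi> q\<bar> ^ a)" if "a \<le> k" "even a" for a
    using quadrature_exact_affine_power[OF assms(2) that(1), of 1 0] that(2)
    by (simp add: power_even_abs) (simp add: field_simps)
  \<comment> \<open>The boolean selects the coordinate that carries the end-point rule.\<close>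
  define J where "J = (I \<times> {1..Q}) \<times> (UNIV :: bool set)"
  define w where "w j = (case j of ((i, q), s) \<Rightarrow> v i * \<omega> q / 2)" for j :: "((nat \<times> nat) \<times> nat) \<times> bool"
  define y where "y j = (case j of ((i, q), s) \<Rightarrow> if s then (t i, \<bar>\<xi> q\<bar>) else (\<bar>\<xi> q\<bar>, t i))" for j
  have "\<exists>S \<omega> z. symmetric_CAD k 0 (e / 2) S \<omega> z"
  proof (rule symmetric_CAD_of_finite_set[of _ J w y])
    show "e / 2 > 0" "finite J" using \<open>e > 0\<close> \<open>finite I\<close> by (auto simp: J_def)
    show "w j > 0" if "j \<in> J" for j using that v pos by (auto simp: w_def J_def)
    show "y j \<in> {0..1} \<times> {0..1}" if "j \<in> J" for j
      using that t \<xi> by (auto simp: y_def J_def split: if_splits)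
    fix a b assume "a + b \<le> k" and even: "even a" "even b"
    then have le: "a \<le> k" "b \<le> k" by auto
    define T where "T a = (\<Sum>i\<in>I. v i * t i ^ a)" for a
    define H where "H a = (\<Sum>q = 1..Q. \<omega> q * \<bar>\<xi> q\<bar> ^ a)" for a
    have "(\<Sum>j\<in>J. w j * (fst (y j) ^ a * snd (y j) ^ b)) =
        (\<Sum>i\<in>I. \<Sum>q = 1..Q. (v i * t i ^ a) * (\<omega> q * \<bar>\<xi> q\<bar> ^ b) / 2 + (v i * t i ^ b) * (\<omega> q * \<bar>\<xi> q\<bar> ^ a) / 2)"
      unfolding J_def sum.cartesian_product'
      by (intro sum.cong refl) (simp add: UNIV_bool w_def y_def algebra_simps)
    also have "\<dots> = T a * H b / 2 + T b * H a / 2"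
      by (simp add: T_def H_def sum_product sum.distrib sum_divide_distrib)
    finally show "1 / real (Suc a) * (1 / real (Suc b)) =
        e / 2 * ((1 + 0) * (1 / real (Suc b)) + (1 - 0) * (1 / real (Suc a)))
        + (\<Sum>j\<in>J. w j * (fst (y j) ^ a * snd (y j) ^ b))"
    proof -
      assume "(\<Sum>j\<in>J. w j * (fst (y j) ^ a * snd (y j) ^ b)) = T a * H b / 2 + T b * H a / 2"
      moreover have "1 / real (Suc a) = e + T a" "1 / real (Suc b) = e + T b"
        "1 / real (Suc a) = H a" "1 / real (Suc b) = H b"
        using rule gauss le even by (simp_all add: T_def H_def)
      moreover have "A * B = e / 2 * ((1 + 0) * B + (1 - 0) * A) + (T a * B / 2 + T b * A / 2)"
        if "A = e + T a" "B = e + T b" for A B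
        using that by (simp add: field_simps)
      ultimately show ?thesis by metis
    qed
  qed
  then show ?thesis by blast
qed

section \<open>Bounds on the boundary weights\<close>

text \<open>As \<open>omega_star\<close> is a supremum, an existing CAD bounds it from below, and
  upper bounds on all members of the nonempty set pass to it.\<close>

lemma omega_star_pos_le:
  assumes "gauss_rule Q \<xi> \<omega>" "quadrature_exact k Q \<xi> \<omega>"
  shows "omega_star 0 k > 0" "omega_star 0 k \<le> 1 / 2" "k \<ge> 2 \<Longrightarrow> omega_star 0 k \<le> 1 / 4"
proof -
  obtain w S \<omega>' z where w: "symmetric_CAD k 0 w S \<omega>' z" using symmetric_CAD_exists[OF assms] by blast
  let ?W = "{w. \<exists>S \<omega> z. symmetric_CAD k 0 w S \<omega> z}"
  have "bdd_above ?W" using symmetric_CAD_weight_le by (intro bdd_aboveI) blast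
  then have "w \<le> omega_star 0 k" unfolding omega_star_def using w by (intro cSup_upper) blast+
  moreover have "w > 0" using w by (simp add: symmetric_CAD_def)
  ultimately show "omega_star 0 k > 0" by simp
  show "omega_star 0 k \<le> 1 / 2" unfolding omega_star_def
    using w symmetric_CAD_weight_le by (intro cSup_least) blast+
  show "omega_star 0 k \<le> 1 / 4" if "k \<ge> 2" unfolding omega_star_def
    using w symmetric_CAD_weight_le_quarter that by (intro cSup_least) blast+
qed

lemma omega_GL_pos_le:
  assumes "k \<ge> 1"
  shows "omega_GL k > 0" "omega_GL k \<le> 1 / 2" "k \<ge> 2 \<Longrightarrow> omega_GL k < 1 / 2"
proof -
  define L where "L = real (GL_points k)"
  have L: "L \<ge> (real k + 3) / 2" unfolding L_def GL_points_def by linarith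
  have int: "L \<ge> 3" if "k \<ge> 2"
  proof -
    \<comment> \<open>The lower bound is at least \<open>5 / 2\<close>, and the number of nodes is
      an integer.\<close>
    have "real (GL_points k) > 2" using L that by (simp add: L_def)
    then have "GL_points k \<ge> 3" by linarith
    then show ?thesis by (simp add: L_def)
  qed
  have "L \<ge> 2" using L assms by simp
  then have "L * (L - 1) \<ge> 2 * 1" by (intro mult_mono) auto
  then show "omega_GL k > 0" "omega_GL k \<le> 1 / 2"
    unfolding omega_GL_def L_def[symmetric] by (auto simp: field_simps)
  show "omega_GL k < 1 / 2" if "k \<ge> 2"
  proof -
    have "L * (L - 1) \<ge> 3 * 2" using int[OF that] by (intro mult_mono) auto
    then show ?thesis unfolding omega_GL_def L_def[symmetric] by (auto simp: field_simps)
  qed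
qed

text \<open>\<open>omega_quasi \<theta> k\<close> is the harmonic mean of \<open>omega_GL k\<close>
  and \<open>omega_star 0 k\<close> with weights \<open>\<bar>\<theta>\<bar>\<close> and
  \<open>1 - \<bar>\<theta>\<bar>\<close>, so it inherits their common bounds.\<close>

lemma omega_quasi_pos_le:
  assumes "gauss_rule Q \<xi> \<omega>" "quadrature_exact k Q \<xi> \<omega>" "k \<ge> 1" "\<bar>\<theta>\<bar> < 1"
  shows "omega_quasi \<theta> k > 0" "omega_quasi \<theta> k \<le> 1 / 2" "k \<ge> 2 \<Longrightarrow> omega_quasi \<theta> k < 1 / 2"
proof -
  define g s where "g = omega_GL k" and "s = omega_star 0 k"
  have pos: "g > 0" "s > 0" and le: "g \<le> 1 / 2" "s \<le> 1 / 2"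
    and less: "k \<ge> 2 \<Longrightarrow> g < 1 / 2" "k \<ge> 2 \<Longrightarrow> s < 1 / 2"
    using omega_GL_pos_le[OF assms(3)] omega_star_pos_le[OF assms(1,2)] by (auto simp: g_def s_def)
  have D: "s * \<bar>\<theta>\<bar> + g * (1 - \<bar>\<theta>\<bar>) > 0" using pos assms(4) by (simp add: add_nonneg_pos)
  have "2 * (s * g) * \<bar>\<theta>\<bar> \<le> s * \<bar>\<theta>\<bar>" "2 * (s * g) * (1 - \<bar>\<theta>\<bar>) \<le> g * (1 - \<bar>\<theta>\<bar>)"
    using pos le assms(4) by (intro mult_right_mono; simp)+
  then have le': "2 * (s * g) \<le> s * \<bar>\<theta>\<bar> + g * (1 - \<bar>\<theta>\<bar>)" by (simp add: algebra_simps)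
  show "omega_quasi \<theta> k > 0" "omega_quasi \<theta> k \<le> 1 / 2"
    unfolding omega_quasi_def g_def[symmetric] s_def[symmetric]
    using pos D le' by (simp_all add: field_simps)
  show "omega_quasi \<theta> k < 1 / 2" if "k \<ge> 2"
  proof -
    have "2 * (s * g) * \<bar>\<theta>\<bar> \<le> s * \<bar>\<theta>\<bar>"
      using pos le by (intro mult_right_mono; simp)
    \<comment> \<open>Strictness comes from this part, since \<open>1 - \<bar>\<theta>\<bar>\<close>
      is positive whereas \<open>\<theta>\<close> may be 0.\<close>
    moreover have "2 * (s * g) * (1 - \<bar>\<theta>\<bar>) < g * (1 - \<bar>\<theta>\<bar>)"
      using pos less[OF that] assms(4) by (intro mult_strict_right_mono; simp)
    ultimately have "2 * (s * g) < s * \<bar>\<theta>\<bar> + g * (1 - \<bar>\<theta>\<bar>)" by (simp add: algebra_simps)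
    then show ?thesis unfolding omega_quasi_def g_def[symmetric] s_def[symmetric]
      using D by (simp add: field_simps)
  qed
qed

section \<open>Cell and edge averages of affine functions\<close>

lemma Pk_1_affine:
  assumes "p \<in> Pk 1"
  obtains A B C where "\<And>x y. p (x, y) = A + B * x + C * y"
proof -
  obtain c where "\<And>x y. p (x, y) = (\<Sum>a\<le>1. \<Sum>b\<le>1 - a. c a b * x ^ a * y ^ b)"
    using assms by (auto simp: Pk_def)
  then have "p (x, y) = c 0 0 + c 1 0 * x + c 0 1 * y" for x y by simp
  then show thesis by (rule that)
qed

lemma has_integral_affine:
  fixes A B a b :: real
  assumes "a \<le> b"
  shows "((\<lambda>x. A + B * x) has_integral (b - a) * (A + B * ((a + b) / 2))) {a..b}"
proof -
  have deriv: "((\<lambda>x. A * x + B * x\<^sup>2 / 2) has_vector_derivative A + B * x) (at x within {a..b})" for x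
    unfolding has_real_derivative_iff_has_vector_derivative[symmetric]
    by (auto intro!: derivative_eq_intros)
  have eq: "A * b + B * b\<^sup>2 / 2 - (A * a + B * a\<^sup>2 / 2) = (b - a) * (A + B * ((a + b) / 2))"
    by (simp add: field_simps power2_eq_square)
  show ?thesis using fundamental_theorem_of_calculus[OF assms deriv] unfolding eq .
qed

text \<open>The midpoint rule is exact for affine functions, applied in each variable in
  turn.\<close>

lemma integral_cell_Pk_1:
  assumes "p \<in> Pk 1" "a \<le> b" "c \<le> d"
  shows "integral ({a..b} \<times> {c..d}) p = (b - a) * (d - c) * p ((a + b) / 2, (c + d) / 2)"
proof -
  obtain A B C where p: "\<And>x y. p (x, y) = A + B * x + C * y" using Pk_1_affine[OF assms(1)] by metis
  have inner: "integral {c..d} (\<lambda>y. A + B * x + C * y) =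
      (d - c) * (A + C * ((c + d) / 2)) + (d - c) * B * x" for x
    using has_integral_affine[OF assms(3), of "A + B * x" C, THEN integral_unique]
    by (simp add: algebra_simps)
  have "integral ({a..b} \<times> {c..d}) p = integral {a..b} (\<lambda>x. integral {c..d} (\<lambda>y. p (x, y)))"
    using integral_prod_continuous[of a c b d p] continuous_on_Pk[OF assms(1)]
    by (simp add: cbox_Pair_eq)
  also have "\<dots> = (b - a) * ((d - c) * (A + C * ((c + d) / 2)) + (d - c) * B * ((a + b) / 2))"
    unfolding p inner by (rule has_integral_affine[OF assms(2), THEN integral_unique])
  also have "\<dots> = (b - a) * (d - c) * (A + B * ((a + b) / 2) + C * ((c + d) / 2))"
    by (simp add: field_simps)
  finally show ?thesis by (simp add: p)
qed

lemma cell_avg_Pk_1: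
  assumes "\<And>l. (\<lambda>z. p i j z $ l) \<in> Pk 1" "X i < X (i + 1)" "Y j < Y (j + 1)"
  shows "cell_avg X Y p i j = p i j ((X i + X (i + 1)) / 2, (Y j + Y (j + 1)) / 2)"
proof -
  \<comment> \<open>The vector is rebuilt from its components because \<open>Pk\<close> is a
    condition on each; integrability then permits integrating componentwise.\<close>
  have "continuous_on (cbox (X i, Y j) (X (i + 1), Y (j + 1))) (\<lambda>z. \<chi> l. p i j z $ l)"
    by (intro continuous_on_vec_lambda continuous_on_Pk[OF assms(1)])
  then have "p i j integrable_on {X i..X (i + 1)} \<times> {Y j..Y (j + 1)}"
    using integrable_continuous[of "(X i, Y j)" "(X (i + 1), Y (j + 1))" "p i j"]
    by (simp add: cbox_Pair_eq)
  then have "integral ({X i..X (i + 1)} \<times> {Y j..Y (j + 1)}) (p i j) $ l =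
      (X (i + 1) - X i) * (Y (j + 1) - Y j) *
      p i j ((X i + X (i + 1)) / 2, (Y j + Y (j + 1)) / 2) $ l" for l
    using integral_component_eq_cart[of "p i j" _ l]
      integral_cell_Pk_1[OF assms(1) assms(2,3)[THEN less_imp_le], of l] by simp
  then have "integral ({X i..X (i + 1)} \<times> {Y j..Y (j + 1)}) (p i j) =
      ((X (i + 1) - X i) * (Y (j + 1) - Y j)) *\<^sub>R
      p i j ((X i + X (i + 1)) / 2, (Y j + Y (j + 1)) / 2)"
    unfolding vec_eq_iff by (simp only: vector_scaleR_component real_scaleR_def) blast
  then show ?thesis using assms(2,3) by (simp add: cell_avg_def)
qed

lemma quadrature_exact_moments:
  assumes "quadrature_exact k Q \<xi> \<omega>" "k \<ge> 1"
  shows "(\<Sum>q = 1..Q. \<omega> q) = 1" "(\<Sum>q = 1..Q. \<omega> q * \<xi> q) = 0"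
  using quadrature_exact_affine_power[OF assms(1), of 0 1 0]
    quadrature_exact_affine_power[OF assms(1), of 1 1 0] assms(2) by simp_all

lemma quadrature_affine_nodes:
  assumes "quadrature_exact k Q \<xi> \<omega>" "k \<ge> 1"
  shows "(\<Sum>q = 1..Q. \<omega> q * (A + B * affine_node a b (\<xi> q))) = A + B * ((a + b) / 2)"
proof -
  have "\<omega> q * (A + B * affine_node a b (\<xi> q)) =
      \<omega> q * (A + B * ((a + b) / 2)) + B * ((b - a) / 2) * (\<omega> q * \<xi> q)" for q
    by (simp add: affine_node_def algebra_simps)
  then have "(\<Sum>q = 1..Q. \<omega> q * (A + B * affine_node a b (\<xi> q))) =
      (\<Sum>q = 1..Q. \<omega> q) * (A + B * ((a + b) / 2)) + B * ((b - a) / 2) * (\<Sum>q = 1..Q. \<omega> q * \<xi> q)"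
    by (simp only: sum_distrib_left sum_distrib_right sum.distrib)
  then show ?thesis unfolding quadrature_exact_moments[OF assms] by simp
qed

text \<open>Opposite edges lie symmetrically about the centre of the cell, so an affine function
  averages over them to its value there, which is the cell average.\<close>

lemma boundary_averages_Pk_1:
  assumes "\<And>i j l. (\<lambda>z. p i j z $ l) \<in> Pk 1" "X i < X (i + 1)" "Y j < Y (j + 1)"
    and "quadrature_exact 1 Q \<xi> \<omega>"
  shows "(\<Sum>q = 1..Q. \<omega> q *\<^sub>R (ux_plus X Y \<xi> p i j q + ux_minus X Y \<xi> p (i + 1) j q)) =
      2 *\<^sub>R cell_avg X Y p i j"
    and "(\<Sum>q = 1..Q. \<omega> q *\<^sub>R (uy_plus X Y \<xi> p i j q + uy_minus X Y \<xi> p i (j + 1) q)) =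
      2 *\<^sub>R cell_avg X Y p i j"
proof -
  \<comment> \<open>Both traces come from cell \<open>(i, j)\<close>: \<open>ux_minus\<close> at
    interface \<open>i + 1\<close> reads cell \<open>i + 1 - 1\<close>, and likewise
    \<open>uy_minus\<close> in \<open>j\<close>.\<close>
  have "(\<Sum>q = 1..Q. \<omega> q * (p i j (X i, affine_node (Y j) (Y (j + 1)) (\<xi> q)) $ l +
          p i j (X (i + 1), affine_node (Y j) (Y (j + 1)) (\<xi> q)) $ l)) =
        2 * p i j ((X i + X (i + 1)) / 2, (Y j + Y (j + 1)) / 2) $ l \<and>
      (\<Sum>q = 1..Q. \<omega> q * (p i j (affine_node (X i) (X (i + 1)) (\<xi> q), Y j) $ l +
          p i j (affine_node (X i) (X (i + 1)) (\<xi> q), Y (j + 1)) $ l)) =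
        2 * p i j ((X i + X (i + 1)) / 2, (Y j + Y (j + 1)) / 2) $ l" for l
  proof -
    obtain A B C where p: "\<And>x y. p i j (x, y) $ l = A + B * x + C * y"
      using Pk_1_affine[OF assms(1)] by metis
    have edges: "(A + B * x + C * y) + (A + B * x' + C * y) = (2 * A + B * (x + x')) + (2 * C) * y"
      "(A + B * x + C * y) + (A + B * x + C * y') = (2 * A + C * (y + y')) + (2 * B) * x"
      for x x' y y' by (simp_all add: algebra_simps)
    then show ?thesis
      unfolding p edges quadrature_affine_nodes[OF assms(4) order_refl] by (simp add: field_simps)
  qed
  then show "(\<Sum>q = 1..Q. \<omega> q *\<^sub>R (ux_plus X Y \<xi> p i j q + ux_minus X Y \<xi> p (i + 1) j q)) =
      2 *\<^sub>R cell_avg X Y p i j"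
    and "(\<Sum>q = 1..Q. \<omega> q *\<^sub>R (uy_plus X Y \<xi> p i j q + uy_minus X Y \<xi> p i (j + 1) q)) =
      2 *\<^sub>R cell_avg X Y p i j"
    unfolding cell_avg_Pk_1[OF assms(1-3)]
    by (simp_all add: vec_eq_iff ux_plus_def ux_minus_def uy_plus_def uy_minus_def)
qed

section \<open>Convex combinations and the cell-average update\<close>

text \<open>The flux \<open>f (P q) (M q)\<close> between the two traces of the same cell cancels in the sum of the
  two bound-preserving updates.\<close>

lemma boundary_update_in:
  fixes Q :: nat
  assumes "convex G" "bound_preserving_flux G a c0 f" "\<mu> > 0" "a * \<mu> \<le> c0"
    and "(\<Sum>q = 1..Q. \<omega> q) = 1" "\<And>q. q \<in> {1..Q} \<Longrightarrow> \<omega> q > 0"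
    and "\<And>q. q \<in> {1..Q} \<Longrightarrow> L q \<in> G \<and> P q \<in> G \<and> M q \<in> G \<and> R q \<in> G"
  shows "(1 / 2) *\<^sub>R (\<Sum>q = 1..Q. \<omega> q *\<^sub>R (P q + M q)) -
    (\<mu> / 2) *\<^sub>R (\<Sum>q = 1..Q. \<omega> q *\<^sub>R (f (M q) (R q) - f (L q) (P q))) \<in> G"
proof -
  define U where "U q = (1 / 2) *\<^sub>R (P q - \<mu> *\<^sub>R (f (P q) (M q) - f (L q) (P q))) +
      (1 / 2) *\<^sub>R (M q - \<mu> *\<^sub>R (f (M q) (R q) - f (P q) (M q)))" for q
  have "U q \<in> G" if "q \<in> {1..Q}" for q
    unfolding U_def using assms(2-4) assms(7)[OF that]
    by (intro convexD[OF assms(1)]) (auto simp: bound_preserving_flux_def)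
  then have "(\<Sum>q = 1..Q. \<omega> q *\<^sub>R U q) \<in> G"
    using assms(1,5,6) by (intro convex_sum) (auto intro: less_imp_le)
  moreover have "U q = (1 / 2) *\<^sub>R (P q + M q) - (\<mu> / 2) *\<^sub>R (f (M q) (R q) - f (L q) (P q))" for q
    by (simp add: U_def algebra_simps)
  ultimately show ?thesis
    by (simp add: scaleR_sum_right sum_subtractf scaleR_right_diff_distrib mult.commute)
qed

text \<open>The conditional membership of \<open>x\<close> is tailored to \<open>Pi\<close>, which
  is known to lie in \<open>G\<close> only if its coefficient \<open>1 - 2 * \<omega>Q\<close> is
  nonzero.\<close>

lemma convex_combination_three:
  assumes "convex G" "a \<ge> 0" "b > 0" "c > 0" "a + b + c = 1" "y \<in> G" "z \<in> G"
    and "a \<noteq> 0 \<Longrightarrow> x \<in> G"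
  shows "a *\<^sub>R x + (b *\<^sub>R y + c *\<^sub>R z) \<in> G"
proof -
  define v where "v = (b / (b + c)) *\<^sub>R y + (c / (b + c)) *\<^sub>R z"
  have "v \<in> G" unfolding v_def using assms
    by (intro convexD[OF assms(1)]) (auto simp: add_divide_distrib[symmetric])
  have eq: "b *\<^sub>R y + c *\<^sub>R z = (b + c) *\<^sub>R v" using assms by (simp add: v_def scaleR_right_distrib)
  show ?thesis
  proof (cases "a = 0")
    case True
    then show ?thesis using \<open>v \<in> G\<close> assms(5) by (simp add: eq)
  next
    case False
    then show ?thesis unfolding eq using assms \<open>v \<in> G\<close> by (intro convexD[OF assms(1)]) auto
  qed
qed

theorem theorem7p6:
  fixes G :: "(real ^ 'm) set"
    and a1 a2 dx dy c0 dt \<theta> \<omega>Q :: real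
    and k Q :: nat
    and X Y :: "int \<Rightarrow> real"
    and \<xi> \<omega> :: "nat \<Rightarrow> real"
    and p :: "int \<Rightarrow> int \<Rightarrow> real \<times> real \<Rightarrow> real ^ 'm"
    and f1 f2 :: "real ^ 'm \<Rightarrow> real ^ 'm \<Rightarrow> real ^ 'm"
    and u u_new :: "int \<Rightarrow> int \<Rightarrow> real ^ 'm"
  assumes "convex G"
    and "a1 > 0" "a2 > 0" "dx > 0" "dy > 0" "c0 > 0" "dt > 0" "k \<ge> 1"
    and grid: "\<And>i. X (i + 1) = X i + dx" "\<And>j. Y (j + 1) = Y j + dy"
    and poly: "\<And>i j l. (\<lambda>z. p i j z $ l) \<in> Pk k"
    and averages: "\<And>i j. u i j = cell_avg X Y p i j"
    and gauss: "gauss_rule Q \<xi> \<omega>" "quadrature_exact k Q \<xi> \<omega>"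
    and flux: "bound_preserving_flux G a1 c0 f1" "bound_preserving_flux G a2 c0 f2"
    and scheme: "\<And>i j. u_new i j = u i j
      - (dt / dx) *\<^sub>R (\<Sum>q = 1..Q. \<omega> q *\<^sub>R
          (f1 (ux_minus X Y \<xi> p (i + 1) j q) (ux_plus X Y \<xi> p (i + 1) j q)
           - f1 (ux_minus X Y \<xi> p i j q) (ux_plus X Y \<xi> p i j q)))
      - (dt / dy) *\<^sub>R (\<Sum>q = 1..Q. \<omega> q *\<^sub>R
          (f2 (uy_minus X Y \<xi> p i (j + 1) q) (uy_plus X Y \<xi> p i (j + 1) q)
           - f2 (uy_minus X Y \<xi> p i j q) (uy_plus X Y \<xi> p i j q)))"
    and theta: "\<theta> = (a1 / dx - a2 / dy) / (a1 / dx + a2 / dy)"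
    and weight: "\<omega>Q = omega_quasi \<theta> k"
    and interface: "\<And>i j q. q \<in> {1..Q} \<Longrightarrow>
      ux_plus X Y \<xi> p i j q \<in> G \<and> ux_minus X Y \<xi> p (i + 1) j q \<in> G \<and>
      uy_plus X Y \<xi> p i j q \<in> G \<and> uy_minus X Y \<xi> p i (j + 1) q \<in> G"
    \<comment> \<open>For \<open>k = 1\<close> one has \<open>\<omega>Q = 1/2\<close> and the quotient is \<open>0/0\<close>; nothing is then required.\<close>
    and interior: "\<And>i j. 1 - 2 * \<omega>Q \<noteq> 0 \<Longrightarrow>
      (1 / (1 - 2 * \<omega>Q)) *\<^sub>R
        (u i j - \<omega>Q *\<^sub>R
          (((1 + \<theta>) / 2) *\<^sub>R (\<Sum>q = 1..Q. \<omega> q *\<^sub>R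
              (ux_plus X Y \<xi> p i j q + ux_minus X Y \<xi> p (i + 1) j q))
           + ((1 - \<theta>) / 2) *\<^sub>R (\<Sum>q = 1..Q. \<omega> q *\<^sub>R
              (uy_plus X Y \<xi> p i j q + uy_minus X Y \<xi> p i (j + 1) q)))) \<in> G"
    and CFL: "dt * (a1 / dx + a2 / dy) \<le> \<omega>Q * c0"
  shows "\<forall>i j. u_new i j \<in> G"
proof (intro allI)
  fix i j
  define s where "s = a1 / dx + a2 / dy"
  have "s > 0" using assms(2-5) by (simp add: s_def add_pos_pos)
  \<comment> \<open>This \<open>\<theta>\<close> splits the boundary weight between the directions
    in proportion to \<open>a1 / dx\<close> and \<open>a2 / dy\<close>.\<close>
  have plus: "1 + \<theta> = 2 * (a1 / dx) / s" and minus: "1 - \<theta> = 2 * (a2 / dy) / s"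
    using \<open>s > 0\<close> unfolding theta s_def by (simp_all add: field_simps)
  then have "1 + \<theta> > 0" "1 - \<theta> > 0" using assms(2-5) \<open>s > 0\<close> by simp_all
  then have "\<bar>\<theta>\<bar> < 1" by linarith
  note w = omega_quasi_pos_le[OF gauss \<open>k \<ge> 1\<close> this, folded weight]
  define \<alpha> \<beta> where "\<alpha> = \<omega>Q * (1 + \<theta>)" and "\<beta> = \<omega>Q * (1 - \<theta>)"
  have \<alpha>\<beta>: "\<alpha> > 0" "\<beta> > 0" "\<alpha> + \<beta> = 2 * \<omega>Q"
    unfolding \<alpha>_def \<beta>_def using mult_pos_pos[OF w(1) \<open>1 + \<theta> > 0\<close>] mult_pos_pos[OF w(1) \<open>1 - \<theta> > 0\<close>]
    by (simp_all add: right_diff_distrib distrib_left)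
  \<comment> \<open>Chosen so that \<open>\<alpha> * \<mu>1 / 2 = dt / dx\<close> and
    \<open>\<beta> * \<mu>2 / 2 = dt / dy\<close>. Then \<open>a1 * \<mu>1\<close> and
    \<open>a2 * \<mu>2\<close> are both \<open>dt * s / \<omega>Q\<close>, so one CFL condition
    covers both fluxes.\<close>
  define \<mu>1 \<mu>2 where "\<mu>1 = dt * s / (\<omega>Q * a1)" and "\<mu>2 = dt * s / (\<omega>Q * a2)"
  have \<mu>_pos: "\<mu>1 > 0" "\<mu>2 > 0" using w(1) \<open>s > 0\<close> assms(2,3,7) by (simp_all add: \<mu>1_def \<mu>2_def)
  have \<mu>_le: "a1 * \<mu>1 \<le> c0" "a2 * \<mu>2 \<le> c0"
    using w(1) assms(2,3) CFL[folded s_def]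
    by (simp_all add: \<mu>1_def \<mu>2_def pos_divide_le_eq mult.commute)
  have \<mu>_mult: "\<alpha> * (\<mu>1 / 2) = dt / dx" "\<beta> * (\<mu>2 / 2) = dt / dy"
    using w(1) \<open>s > 0\<close> assms(2-5) unfolding \<alpha>_def \<beta>_def plus minus
    by (simp_all add: \<mu>1_def \<mu>2_def field_simps)
  have \<omega>: "(\<Sum>q = 1..Q. \<omega> q) = 1" "\<And>q. q \<in> {1..Q} \<Longrightarrow> \<omega> q > 0"
    using quadrature_exact_moments(1)[OF gauss(2) \<open>k \<ge> 1\<close>] gauss_weight_pos[OF gauss(1)] by auto
  define BX where "BX = (\<Sum>q = 1..Q. \<omega> q *\<^sub>R
      (ux_plus X Y \<xi> p i j q + ux_minus X Y \<xi> p (i + 1) j q))"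
  define BY where "BY = (\<Sum>q = 1..Q. \<omega> q *\<^sub>R
      (uy_plus X Y \<xi> p i j q + uy_minus X Y \<xi> p i (j + 1) q))"
  define FX where "FX = (\<Sum>q = 1..Q. \<omega> q *\<^sub>R
      (f1 (ux_minus X Y \<xi> p (i + 1) j q) (ux_plus X Y \<xi> p (i + 1) j q)
       - f1 (ux_minus X Y \<xi> p i j q) (ux_plus X Y \<xi> p i j q)))"
  define FY where "FY = (\<Sum>q = 1..Q. \<omega> q *\<^sub>R
      (f2 (uy_minus X Y \<xi> p i (j + 1) q) (uy_plus X Y \<xi> p i (j + 1) q)
       - f2 (uy_minus X Y \<xi> p i j q) (uy_plus X Y \<xi> p i j q)))"
  \<comment> \<open>The outer traces belong to the four neighbouring cells, so
    \<open>interface\<close> is applied there too.\<close>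
  have traces: "ux_minus X Y \<xi> p i j q \<in> G \<and> ux_plus X Y \<xi> p i j q \<in> G \<and>
      ux_minus X Y \<xi> p (i + 1) j q \<in> G \<and> ux_plus X Y \<xi> p (i + 1) j q \<in> G"
    "uy_minus X Y \<xi> p i j q \<in> G \<and> uy_plus X Y \<xi> p i j q \<in> G \<and>
      uy_minus X Y \<xi> p i (j + 1) q \<in> G \<and> uy_plus X Y \<xi> p i (j + 1) q \<in> G"
    if "q \<in> {1..Q}" for q
    using interface[OF that, of i j] interface[OF that, of "i - 1" j] interface[OF that, of "i + 1" j]
      interface[OF that, of i "j - 1"] interface[OF that, of i "j + 1"] by auto
  have SX: "(1 / 2) *\<^sub>R BX - (\<mu>1 / 2) *\<^sub>R FX \<in> G"
    unfolding BX_def FX_def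
    by (rule boundary_update_in[OF \<open>convex G\<close> flux(1) \<mu>_pos(1) \<mu>_le(1) \<omega> traces(1)])
  have SY: "(1 / 2) *\<^sub>R BY - (\<mu>2 / 2) *\<^sub>R FY \<in> G"
    unfolding BY_def FY_def
    by (rule boundary_update_in[OF \<open>convex G\<close> flux(2) \<mu>_pos(2) \<mu>_le(2) \<omega> traces(2)])
  \<comment> \<open>If \<open>\<omega>Q = 1 / 2\<close>, division by zero makes \<open>Pi\<close>
    the zero vector, possibly outside \<open>G\<close>, but its coefficient is then zero as
    well.\<close>
  define Pi where "Pi = (1 / (1 - 2 * \<omega>Q)) *\<^sub>R
      (u i j - \<omega>Q *\<^sub>R (((1 + \<theta>) / 2) *\<^sub>R BX + ((1 - \<theta>) / 2) *\<^sub>R BY))"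
  have Pi: "1 - 2 * \<omega>Q \<noteq> 0 \<Longrightarrow> Pi \<in> G"
    using interior[of i j] by (simp add: Pi_def BX_def BY_def)
  have u: "u i j = (1 - 2 * \<omega>Q) *\<^sub>R Pi + \<alpha> *\<^sub>R ((1 / 2) *\<^sub>R BX) + \<beta> *\<^sub>R ((1 / 2) *\<^sub>R BY)"
  proof (cases "1 - 2 * \<omega>Q = 0")
    case True
    \<comment> \<open>The strict bound for \<open>k \<ge> 2\<close> leaves only
      \<open>k = 1\<close>. Both halved edge sums then equal \<open>u i j\<close>, and their
      coefficients satisfy \<open>\<alpha> + \<beta> = 1\<close>.\<close>
    then have "k = 1" using w(3) \<open>k \<ge> 1\<close> by (cases "k \<ge> 2") auto
    have "X i < X (i + 1)" "Y j < Y (j + 1)" using grid \<open>dx > 0\<close> \<open>dy > 0\<close> by simp_all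
    then have "BX = 2 *\<^sub>R u i j" "BY = 2 *\<^sub>R u i j"
      unfolding BX_def BY_def averages
      using boundary_averages_Pk_1[of p X i Y j Q \<xi> \<omega>] poly gauss(2) \<open>k = 1\<close> by auto
    then show ?thesis using True \<alpha>\<beta>(3) by (simp add: scaleR_left_distrib[symmetric])
  next
    case False
    then show ?thesis by (simp add: Pi_def \<alpha>_def \<beta>_def scaleR_right_distrib)
  qed
  have "u_new i j = u i j - (dt / dx) *\<^sub>R FX - (dt / dy) *\<^sub>R FY"
    unfolding scheme FX_def FY_def ..
  also have "\<dots> = (1 - 2 * \<omega>Q) *\<^sub>R Pi + (\<alpha> *\<^sub>R ((1 / 2) *\<^sub>R BX - (\<mu>1 / 2) *\<^sub>R FX) +
      \<beta> *\<^sub>R ((1 / 2) *\<^sub>R BY - (\<mu>2 / 2) *\<^sub>R FY))"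
    unfolding u scaleR_right_diff_distrib scaleR_scaleR \<mu>_mult by simp
  also have "\<dots> \<in> G"
    using w(2) \<alpha>\<beta> Pi by (intro convex_combination_three \<open>convex G\<close> SX SY) auto
  finally show "u_new i j \<in> G" .
qed

end
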